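(* For every integer $n\ge 1$, the matrix ring over dual numbers $M_n(\mathbb{D})$ is not strongly nil-clean.
   Context: $\mathbb{D}=\{a+b\epsilon \mid a,b\in\mathbb{R},\ \epsilon^2=0\}$ is the ring of dual numbers, and $M_n(\mathbb{D})$ is the ring of $n\times n$ matrices over $\mathbb{D}$. An element $a$ of a ring $R$ (associative with identity) is strongly nil-clean if $a=e+t$ where $e\in R$ is idempotent, $t\in R$ is nilpotent, and $et=te$. A ring is strongly nil-clean if every element of it is strongly nil-clean. *)

theory Defs
  imports Complex_Main "HOL-Algebra.Ring" "Jordan_Normal_Form.Matrix"
begin

section \<open>Strongly nil-clean rings\<close>

definition idempotent_elem :: "('a, 'b) ring_scheme \<Rightarrow> 'a \<Rightarrow> bool" where
  "idempotent_elem R e \<longleftrightarrow> e \<in> carrier R \<and> e \<otimes>\<^bsub>R\<^esub> e = e"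

definition nilpotent_elem :: "('a, 'b) ring_scheme \<Rightarrow> 'a \<Rightarrow> bool" where
  "nilpotent_elem R t \<longleftrightarrow> t \<in> carrier R \<and> (\<exists>k::nat. k \<ge> 1 \<and> t [^]\<^bsub>R\<^esub> k = \<zero>\<^bsub>R\<^esub>)"

definition strongly_nil_clean_elem :: "('a, 'b) ring_scheme \<Rightarrow> 'a \<Rightarrow> bool" where
  "strongly_nil_clean_elem R a \<longleftrightarrow>
     (\<exists>e t. idempotent_elem R e \<and> nilpotent_elem R t \<and>
            a = e \<oplus>\<^bsub>R\<^esub> t \<and> e \<otimes>\<^bsub>R\<^esub> t = t \<otimes>\<^bsub>R\<^esub> e)"

text \<open>As usual in HOL-Algebra, the predicate is meant for \<open>R\<close> satisfying \<^locale>\<open>ring\<close>; that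
  requirement is not part of the definition, so that its negation says that some element fails
  to be strongly nil-clean.\<close>

definition strongly_nil_clean :: "('a, 'b) ring_scheme \<Rightarrow> bool" where
  "strongly_nil_clean R \<longleftrightarrow> (\<forall>a \<in> carrier R. strongly_nil_clean_elem R a)"

section \<open>Dual numbers\<close>

text \<open>\<open>Dual a b\<close> stands for \<open>a + b\<epsilon>\<close>; multiplication is the expansion of
  \<open>(a + b\<epsilon>)(c + d\<epsilon>)\<close> modulo \<open>\<epsilon>\<^sup>2 = 0\<close>.\<close>

datatype dual_num = Dual (real_part: real) (eps_part: real)

instantiation dual_num :: comm_ring_1
begin

definition zero_dual_num :: dual_num where
  "0 = Dual 0 0"

definition one_dual_num :: dual_num where
  "1 = Dual 1 0"

definition plus_dual_num :: "dual_num \<Rightarrow> dual_num \<Rightarrow> dual_num" where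
  "x + y = Dual (real_part x + real_part y) (eps_part x + eps_part y)"

definition uminus_dual_num :: "dual_num \<Rightarrow> dual_num" where
  "- x = Dual (- real_part x) (- eps_part x)"

definition minus_dual_num :: "dual_num \<Rightarrow> dual_num \<Rightarrow> dual_num" where
  "x - y = Dual (real_part x - real_part y) (eps_part x - eps_part y)"

definition times_dual_num :: "dual_num \<Rightarrow> dual_num \<Rightarrow> dual_num" where
  "x * y = Dual (real_part x * real_part y)
                (real_part x * eps_part y + eps_part x * real_part y)"

instance
  by standard
    (simp_all add: zero_dual_num_def one_dual_num_def plus_dual_num_def uminus_dual_num_def
      minus_dual_num_def times_dual_num_def algebra_simps)

end

definition dual_eps :: dual_num where
  "dual_eps = Dual 0 1"

lemma dual_eps_square: "dual_eps ^ 2 = 0"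
  by (simp add: dual_eps_def power2_eq_square times_dual_num_def zero_dual_num_def)

lemma Dual_eq: "Dual a b = Dual a 0 + Dual b 0 * dual_eps"
  by (simp add: dual_eps_def plus_dual_num_def times_dual_num_def)

section \<open>Matrices over the dual numbers\<close>

abbreviation dual_matrix_ring :: "nat \<Rightarrow> dual_num mat ring" where
  "dual_matrix_ring n \<equiv> ring_mat TYPE(dual_num) n ()"

lemma ring_dual_matrix_ring: "ring (dual_matrix_ring n)"
  by (rule ring_mat)

end

theory Submission
  imports Defs
begin

text \<open>The scalar matrix \<open>2\<close> is not strongly nil-clean. If \<open>2 = e + t\<close> with \<open>e\<close> idempotent, then
  \<open>t e + e = (e + t) e = 2 e\<close>, so \<open>t e = e\<close> and \<open>t (1 + e) = t + e = 2\<close>. As \<open>2\<close> is a unit, \<open>t\<close> is right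
  invertible, and a right invertible nilpotent element exists only in the zero ring.\<close>

text \<open>Multiplying \<open>t [^] Suc k = \<zero>\<close> on the right by \<open>v\<close>
  cancels one factor \<open>t\<close>, so the exponent descends to \<open>0\<close>, where the power
  is \<open>\<one>\<close>.\<close>

lemma (in ring) nilpotent_right_invertible_imp_trivial:
  assumes "nilpotent_elem R t" and v: "v \<in> carrier R" and tv: "t \<otimes> v = \<one>"
  shows "\<one> = \<zero>"
proof -
  from assms(1) obtain k :: nat where t: "t \<in> carrier R" and k: "t [^] k = \<zero>"
    by (auto simp: nilpotent_elem_def)
  from k show ?thesis
  proof (induction k)
    case (Suc k)
    have "t [^] k = t [^] k \<otimes> (t \<otimes> v)"
      using t tv by simp
    also have "\<dots> = t [^] Suc k \<otimes> v"
      using t v by (simp add: m_assoc)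
    finally show ?case
      using Suc v by simp
  qed simp
qed

lemma (in ring) strongly_nil_clean_two_imp_trivial:
  assumes "strongly_nil_clean_elem R (\<one> \<oplus> \<one>)"
    and h: "h \<in> carrier R" and inv: "(\<one> \<oplus> \<one>) \<otimes> h = \<one>"
  shows "\<one> = \<zero>"
proof -
  from assms(1) obtain e t where e: "e \<in> carrier R" "e \<otimes> e = e"
    and nil: "nilpotent_elem R t" and sum: "\<one> \<oplus> \<one> = e \<oplus> t"
    by (auto simp: strongly_nil_clean_elem_def idempotent_elem_def)
  have t: "t \<in> carrier R"
    using nil by (simp add: nilpotent_elem_def)
  have "e \<oplus> t \<otimes> e = (e \<oplus> t) \<otimes> e"
    using e t by (simp add: l_distr)
  also have "\<dots> = e \<oplus> e"
    using e by (simp add: l_distr flip: sum)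
  finally have "t \<otimes> e = e"
    using e t by simp
  then have "t \<otimes> (\<one> \<oplus> e) = \<one> \<oplus> \<one>"
    using e t by (simp add: r_distr sum a_comm)
  \<comment> \<open>Multiplying by \<open>h\<close> on the right turns this factorization of 2 into
    a right inverse of \<open>t\<close>.\<close>
  then have "t \<otimes> ((\<one> \<oplus> e) \<otimes> h) = \<one>"
    using e t h inv by (simp flip: m_assoc)
  then show ?thesis
    using e h by (intro nilpotent_right_invertible_imp_trivial[OF nil]) simp_all
qed

theorem proposition4p7:
  fixes n :: nat
  assumes "n \<ge> 1"
  shows "\<not> strongly_nil_clean (dual_matrix_ring n)"
proof
  assume clean: "strongly_nil_clean (dual_matrix_ring n)"
  let ?R = "dual_matrix_ring n"
  interpret ring ?R
    by (rule ring_dual_matrix_ring)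
  \<comment> \<open>The scalar matrix 1/2: the real number 2 is a unit among the dual
    numbers.\<close>
  define h :: "dual_num mat" where "h = Dual (1/2) 0 \<cdot>\<^sub>m 1\<^sub>m n"
  have h: "h \<in> carrier ?R"
    by (simp add: h_def ring_mat_simps)
  have "(1\<^sub>m n + 1\<^sub>m n) * h = h + h"
    using h by (simp add: ring_mat_simps add_mult_distrib_mat[of _ n n])
  also have "\<dots> = 1\<^sub>m n"
    by (rule eq_matI)
      (auto simp: h_def plus_dual_num_def one_dual_num_def zero_dual_num_def times_dual_num_def)
  finally have inv: "(\<one>\<^bsub>?R\<^esub> \<oplus>\<^bsub>?R\<^esub> \<one>\<^bsub>?R\<^esub>) \<otimes>\<^bsub>?R\<^esub> h = \<one>\<^bsub>?R\<^esub>"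
    by (simp add: ring_mat_simps)
  have "strongly_nil_clean_elem ?R (\<one>\<^bsub>?R\<^esub> \<oplus>\<^bsub>?R\<^esub> \<one>\<^bsub>?R\<^esub>)"
    using clean unfolding strongly_nil_clean_def by blast
  from strongly_nil_clean_two_imp_trivial[OF this h inv]
  have "(1\<^sub>m n :: dual_num mat) = 0\<^sub>m n n"
    by (simp add: ring_mat_simps)
  \<comment> \<open>Since \<open>n \<ge> 1\<close>, the entry at \<open>(0, 0)\<close> exists and
    gives 1 = 0 in the dual numbers; for \<open>n = 0\<close> the matrix ring is the zero
    ring.\<close>
  then have "(1\<^sub>m n :: dual_num mat) $$ (0, 0) = 0\<^sub>m n n $$ (0, 0)"
    by simp
  then show False
    using assms by simp
qed

end
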